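(* Let $0<q<1$, $p>-1$, and let $\alpha,\beta>0$. Let $f$ be a function on $(0,\infty)$ such that the Jackson integrals defining $J_{p,q}^{\beta}f$, $J_{p,q}^{\alpha}(J_{p,q}^{\beta}f)$ and $J_{p,q}^{\alpha+\beta}f$ exist. Then the $q$-fractional integral operator $J_{p,q}$ has the semigroup property: for $x>0$, $$J_{p,q}^{\alpha}\left(J_{p,q}^{\beta}f\right)(x)=J_{p,q}^{\alpha+\beta}f(x).$$
   Context: Jackson integral: for $b>0$, $\int_0^b g(t)\,d_qt=(1-q)\,b\sum_{i=0}^{\infty}q^i g(q^i b)$; the integral exists when this series converges (for instance, if $|g(t)t^{\gamma}|$ is bounded on $(0,b]$ for some $0\le\gamma<1$). Notation: $(a;r)_\infty=\prod_{j=0}^{\infty}(1-r^j a)$ for $|r|<1$. For a real exponent $\alpha$ and $x>0$, $$(x-y)_{q^{p+1}}^{(\alpha)}=x^{\alpha}\prod_{k=0}^{\infty}\frac{x-y\,(q^{p+1})^{k}}{x-y\,(q^{p+1})^{k+\alpha}}=\frac{x^{\alpha}\left(\frac{y}{x};q^{p+1}\right)_\infty}{\left(q^{\alpha(p+1)}\frac{y}{x};q^{p+1}\right)_\infty}.$$ The $q$-fractional integral operator: for $\alpha>0$ and $x>0$, whenever the Jackson integral exists, $$J_{p,q}^{\alpha}f(x)=\frac{(1-q)^{\alpha-1}}{(1-q^{p+1})_{q^{p+1}}^{(\alpha-1)}}\int_0^{x}w^{p}f(w)\,\left(x^{p+1}-(wq)^{p+1}\right)_{q^{p+1}}^{(\alpha-1)}\,d_qw,$$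 where $(1-q^{p+1})_{q^{p+1}}^{(\alpha-1)}$ is the symbol above evaluated at first entry $1$ and second entry $q^{p+1}$. *)

theory Defs
  imports "HOL-Analysis.Analysis"
begin

text \<open>
  The Jackson integral of \<open>g\<close> over \<open>(0, b]\<close>. It is meaningful only if \<open>jackson_integrable q b g\<close>
  holds; convergence of the series is not required to be absolute.
\<close>

definition jackson_integrable :: "real \<Rightarrow> real \<Rightarrow> (real \<Rightarrow> real) \<Rightarrow> bool" where
  "jackson_integrable q b g \<longleftrightarrow> summable (\<lambda>i. q ^ i * g (q ^ i * b))"

definition jackson_integral :: "real \<Rightarrow> real \<Rightarrow> (real \<Rightarrow> real) \<Rightarrow> real" where
  "jackson_integral q b g = (1 - q) * b * (\<Sum>i. q ^ i * g (q ^ i * b))"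

text \<open>\<open>qdiff_pow r a x y\<close> is \<open>(x - y)\<close> to the \<open>r\<close>-power \<open>(a)\<close>, for \<open>0 < r < 1\<close>, \<open>x > 0\<close>, real \<open>a\<close>.\<close>

definition qdiff_pow :: "real \<Rightarrow> real \<Rightarrow> real \<Rightarrow> real \<Rightarrow> real" where
  "qdiff_pow r a x y =
     x powr a * prodinf (\<lambda>k. (x - y * r ^ k) / (x - y * r powr (real k + a)))"

definition qfrac_integrand ::
    "real \<Rightarrow> real \<Rightarrow> real \<Rightarrow> (real \<Rightarrow> real) \<Rightarrow> real \<Rightarrow> real \<Rightarrow> real" where
  "qfrac_integrand p q \<alpha> f x w =
     w powr p * f w *
     qdiff_pow (q powr (p + 1)) (\<alpha> - 1) (x powr (p + 1)) ((w * q) powr (p + 1))"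

definition qfrac_integral_exists ::
    "real \<Rightarrow> real \<Rightarrow> real \<Rightarrow> (real \<Rightarrow> real) \<Rightarrow> real \<Rightarrow> bool" where
  "qfrac_integral_exists p q \<alpha> f x \<longleftrightarrow> jackson_integrable q x (qfrac_integrand p q \<alpha> f x)"

text \<open>
  The operator \<open>J\<close> with parameters \<open>p\<close>, \<open>q\<close> and order \<open>\<alpha>\<close>. Its value at \<open>x > 0\<close> is meaningful only
  if \<open>qfrac_integral_exists p q \<alpha> f x\<close>, and depends on \<open>f\<close> only through its values on \<open>(0, \<infinity>)\<close>.
\<close>

definition qfrac_integral ::
    "real \<Rightarrow> real \<Rightarrow> real \<Rightarrow> (real \<Rightarrow> real) \<Rightarrow> real \<Rightarrow> real" where
  "qfrac_integral p q \<alpha> f x =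
     (1 - q) powr (\<alpha> - 1) / qdiff_pow (q powr (p + 1)) (\<alpha> - 1) 1 (q powr (p + 1)) *
     jackson_integral q x (qfrac_integrand p q \<alpha> f x)"

end

theory Submission
  imports Defs
begin

text \<open>
  With \<open>r = q powr (p + 1)\<close> and \<open>c\<^sub>\<alpha>(i) = (r\<^sup>\<alpha>; r)\<^sub>i / (r; r)\<^sub>i\<close>, the operator is the series
  \<open>J\<^sup>\<alpha> f(x) = (1 - q)\<^sup>\<alpha> x\<^bsup>(p+1)\<alpha>\<^esup> \<Sum>i. c\<^sub>\<alpha>(i) r\<^sup>i f(q\<^sup>i x)\<close>. Composing two of them and collecting
  the terms with the same \<open>f(q\<^sup>n x)\<close>, the semigroup law becomes the \<open>q\<close>-Vandermonde identity
  \<open>\<Sum>i\<le>n. c\<^sub>\<alpha>(i) r\<^bsup>\<beta>i\<^esup> c\<^sub>\<beta>(n - i) = c\<^sub>\<alpha>\<^sub>+\<^sub>\<beta>(n)\<close>. The series need not converge absolutely,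
  so the rearrangement is justified by Abel summation: \<open>c\<^sub>\<alpha>\<close> and \<open>1 / c\<^sub>\<alpha>\<close> have bounded variation,
  hence \<open>\<Sum>n. r\<^sup>n f(q\<^sup>n x)\<close> converges, and its tails are bounded.
\<close>

section \<open>Quotients of finite q-shifted factorials, their boundedness and bounded
  variation\<close>

text \<open>This is \<open>(A; r)_n / (B; r)_n\<close>. Both parameters stay free so that exchanging
  them gives the reciprocal sequence: \<open>B = r\<close> yields the coefficients of the operator,
  \<open>A = r\<close> their inverses.\<close>

definition qratio :: "real \<Rightarrow> real \<Rightarrow> real \<Rightarrow> nat \<Rightarrow> real" where
  "qratio r A B n = (\<Prod>k<n. (1 - A * r ^ k) / (1 - B * r ^ k))"

lemma qratio_0 [simp]: "qratio r A B 0 = 1"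
  by (simp add: qratio_def)

lemma qratio_Suc: "qratio r A B (Suc n) = qratio r A B n * ((1 - A * r ^ n) / (1 - B * r ^ n))"
  by (simp add: qratio_def)

lemma mult_power_le:
  fixes c r :: real
  assumes "0 < c" "0 < r" "r < 1"
  shows "c * r ^ k \<le> c"
  using assms by (simp add: power_le_one)

lemma mult_power_neq_1:
  fixes c r :: real
  assumes "0 < c" "c < 1" "0 < r" "r < 1"
  shows "c * r ^ k \<noteq> 1"
  using mult_power_le[of c r k] assms by linarith

lemma qratio_mult_swap:
  assumes "0 < r" "r < 1" "0 < A" "A < 1" "0 < B" "B < 1"
  shows "qratio r A B n * qratio r B A n = 1"
proof -
  have "1 - A * r ^ k \<noteq> 0" "1 - B * r ^ k \<noteq> 0" for k
    using mult_power_neq_1[of A r k] mult_power_neq_1[of B r k] assms by simp_all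
  then show ?thesis
    by (simp add: qratio_def flip: prod.distrib)
qed

context
  fixes r A B :: real
  assumes r: "0 < r" "r < 1" and A: "0 < A" "A < 1" and B: "0 < B" "B < 1"
begin

text \<open>A factor minus 1 equals \<open>(B - A) * r ^ k / (1 - B * r ^ k)\<close>, and the
  denominator is at least \<open>1 - B\<close>, so a geometric series dominates.\<close>

lemma summable_qratio_factor: "summable (\<lambda>k. norm ((1 - A * r ^ k) / (1 - B * r ^ k) - 1))"
proof (rule summable_comparison_test')
  show "summable (\<lambda>k. \<bar>B - A\<bar> / (1 - B) * r ^ k)"
    using r by (intro summable_mult summable_geometric) auto
  show "norm (norm ((1 - A * r ^ k) / (1 - B * r ^ k) - 1)) \<le> \<bar>B - A\<bar> / (1 - B) * r ^ k" for k
  proof -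
    have ge: "1 - B * r ^ k \<ge> 1 - B"
      using mult_power_le[of B r k] r B by simp
    then have pos: "1 - B * r ^ k > 0" using B by linarith
    have "(1 - A * r ^ k) / (1 - B * r ^ k) - 1 = (B - A) * r ^ k / (1 - B * r ^ k)"
      using pos by (simp add: field_simps)
    then have "norm (norm ((1 - A * r ^ k) / (1 - B * r ^ k) - 1)) = \<bar>B - A\<bar> * r ^ k / (1 - B * r ^ k)"
      using pos r by (simp add: abs_mult)
    also have "\<dots> \<le> \<bar>B - A\<bar> * r ^ k / (1 - B)"
      using ge pos r B by (intro divide_left_mono mult_pos_pos) auto
    finally show ?thesis by simp
  qed
qed

lemma convergent_prod_qratio: "convergent_prod (\<lambda>k. (1 - A * r ^ k) / (1 - B * r ^ k))"
  by (intro abs_convergent_prod_imp_convergent_prod summable_imp_abs_convergent_prod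
      summable_qratio_factor)

lemma Bseq_qratio: "Bseq (qratio r A B)"
proof -
  have "(\<lambda>n. \<Prod>k\<le>n. (1 - A * r ^ k) / (1 - B * r ^ k)) \<longlonglongrightarrow>
      prodinf (\<lambda>k. (1 - A * r ^ k) / (1 - B * r ^ k))"
    by (rule convergent_prod_LIMSEQ[OF convergent_prod_qratio])
  then have "Bseq (\<lambda>n. qratio r A B (Suc n))"
    unfolding qratio_def lessThan_Suc_atMost by (intro convergent_imp_Bseq convergentI)
  then show ?thesis
    by (rule Bseq_Suc_iff[THEN iffD1])
qed

text \<open>Each increment is the current value, which is bounded, times the deviation of the next
  factor from 1, which is summable.\<close>

lemma summable_qratio_diff: "summable (\<lambda>n. \<bar>qratio r A B (Suc n) - qratio r A B n\<bar>)"
proof -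
  obtain K where K: "K > 0" "\<And>n. norm (qratio r A B n) \<le> K"
    using Bseq_qratio by (auto simp: Bseq_def)
  show ?thesis
  proof (rule summable_comparison_test')
    show "summable (\<lambda>n. K * norm ((1 - A * r ^ n) / (1 - B * r ^ n) - 1))"
      by (intro summable_mult summable_qratio_factor)
    show "norm \<bar>qratio r A B (Suc n) - qratio r A B n\<bar>
        \<le> K * norm ((1 - A * r ^ n) / (1 - B * r ^ n) - 1)" for n
    proof -
      have "qratio r A B (Suc n) - qratio r A B n
          = qratio r A B n * ((1 - A * r ^ n) / (1 - B * r ^ n) - 1)"
        by (simp add: qratio_Suc right_diff_distrib)
      then show ?thesis
        using K(2)[of n] by (simp add: abs_mult mult_right_mono)
    qed
  qed
qed

end

section \<open>Generating functions and the q-Vandermonde identity\<close>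

text \<open>The substitution of \<open>c z\<close> for the variable \<open>z\<close> in a formal
  power series.\<close>

definition fps_dilate :: "real \<Rightarrow> real fps \<Rightarrow> real fps" where
  "fps_dilate c F = Abs_fps (\<lambda>n. c ^ n * fps_nth F n)"

lemma fps_dilate_mult: "fps_dilate c (F * G) = fps_dilate c F * fps_dilate c G"
proof (rule fps_ext)
  fix n
  have "c ^ n = c ^ i * c ^ (n - i)" if "i \<in> {0..n}" for i
    using that by (simp flip: power_add)
  then show "fps_nth (fps_dilate c (F * G)) n = fps_nth (fps_dilate c F * fps_dilate c G) n"
    by (simp add: fps_dilate_def fps_mult_nth sum_distrib_left algebra_simps)
qed

lemma fps_dilate_dilate: "fps_dilate c (fps_dilate d F) = fps_dilate (c * d) F"
  by (simp add: fps_dilate_def fps_eq_iff power_mult_distrib)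

lemma fps_dilate_one_minus:
  "fps_dilate c (1 - fps_const a * fps_X) = 1 - fps_const (a * c) * fps_X"
  by (rule fps_ext) (auto simp: fps_dilate_def fps_X_def)

text \<open>Comparing coefficients gives exactly the recurrence
  \<open>(1 - r ^ Suc m) * c (Suc m) = (1 - A * r ^ m) * c m\<close> of \<open>qratio\<close>. The
  factor \<open>fps_const 1\<close> keeps both linear terms in the form to which
  \<open>fps_dilate_one_minus\<close> applies.\<close>

lemma qbinomial_functional_equation:
  fixes r A :: real
  assumes r: "0 < r" "r < 1"
  defines "F \<equiv> Abs_fps (qratio r A r)"
  shows "(1 - fps_const 1 * fps_X) * F = (1 - fps_const A * fps_X) * fps_dilate r F"
proof (rule fps_ext)
  fix n
  show "fps_nth ((1 - fps_const 1 * fps_X) * F) n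
      = fps_nth ((1 - fps_const A * fps_X) * fps_dilate r F) n"
  proof (cases n)
    case 0
    then show ?thesis by (simp add: F_def fps_dilate_def)
  next
    case (Suc m)
    have "r ^ Suc m < 1" using r by (intro power_Suc_less_one)
    then have "r * r ^ m \<noteq> 1" by simp
    then have "qratio r A r (Suc m) - qratio r A r m
        = r ^ Suc m * qratio r A r (Suc m) - A * (r ^ m * qratio r A r m)"
      by (simp add: qratio_Suc divide_simps) (simp add: algebra_simps)
    then show ?thesis
      by (simp add: Suc F_def fps_dilate_def left_diff_distrib mult.assoc)
  qed
qed

text \<open>Both sides have the generating function solving
  \<open>(1 - z) G(z) = (1 - A B z) G(r z)\<close>, \<open>G(0) = 1\<close>.\<close>

lemma qVandermonde:
  fixes r A B :: real
  assumes r: "0 < r" "r < 1" and B: "B < 1"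
  shows "(\<Sum>i\<le>n. qratio r A r i * B ^ i * qratio r B r (n - i)) = qratio r (A * B) r n"
proof -
  define F where "F = Abs_fps (qratio r A r)"
  define H where "H = Abs_fps (qratio r B r)"
  define G where "G = fps_dilate B F * H"
  let ?l = "\<lambda>a. 1 - fps_const a * fps_X :: real fps"
  have F: "?l B * fps_dilate B F = ?l (A * B) * fps_dilate B (fps_dilate r F)"
    using arg_cong[OF qbinomial_functional_equation[OF r, of A], of "fps_dilate B"]
    unfolding fps_dilate_mult fps_dilate_one_minus F_def by simp
  have H: "?l 1 * H = ?l B * fps_dilate r H"
    unfolding H_def by (rule qbinomial_functional_equation[OF r])
  have dil: "fps_dilate r G = fps_dilate B (fps_dilate r F) * fps_dilate r H"
    by (simp add: G_def fps_dilate_mult fps_dilate_dilate mult.commute)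
  \<comment> \<open>The equation of \<open>F\<close> at \<open>B z\<close> has
    \<open>1 - B z\<close> on its left side, that of \<open>H\<close> has it on its right. In the
    product of the two it is a common nonzero factor and cancels.\<close>
  have "?l B * (?l 1 * G) = (?l B * fps_dilate B F) * (?l 1 * H)"
    by (simp only: G_def mult_ac)
  also have "\<dots> = ?l B * (?l (A * B) * fps_dilate r G)"
    unfolding F H dil by (simp only: mult_ac)
  finally have *: "?l B * (?l 1 * G) = ?l B * (?l (A * B) * fps_dilate r G)" .
  have "fps_nth (?l B) 0 = 1" by simp
  then have "?l B \<noteq> 0" by (metis fps_zero_nth zero_neq_one)
  with * have eq: "?l 1 * G = ?l (A * B) * fps_dilate r G"
    by (metis mult_left_cancel)
  \<comment> \<open>Since \<open>1 - r ^ Suc n\<close> is nonzero, the functional equation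
    determines each coefficient from the previous one.\<close>
  have "fps_nth G n = qratio r (A * B) r n"
  proof (induction n)
    case 0
    then show ?case by (simp add: G_def F_def H_def fps_dilate_def)
  next
    case (Suc n)
    have "r ^ Suc n < 1" using r by (intro power_Suc_less_one)
    then have nz: "1 - r * r ^ n \<noteq> 0" by simp
    have "fps_nth (?l 1 * G) (Suc n) = fps_nth (?l (A * B) * fps_dilate r G) (Suc n)"
      by (simp only: eq)
    then have "fps_nth G (Suc n) - fps_nth G n
        = r ^ Suc n * fps_nth G (Suc n) - A * B * (r ^ n * fps_nth G n)"
      by (simp add: fps_dilate_def left_diff_distrib mult.assoc)
    then have "fps_nth G (Suc n) * (1 - r * r ^ n) = fps_nth G n * (1 - A * B * r ^ n)"
      by (simp add: algebra_simps)
    with nz have "fps_nth G (Suc n) = fps_nth G n * ((1 - A * B * r ^ n) / (1 - r * r ^ n))"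
      by (simp add: field_simps)
    with Suc.IH show ?case by (simp add: qratio_Suc)
  qed
  then show ?thesis
    unfolding G_def F_def H_def fps_dilate_def fps_mult_nth atLeast0AtMost fps_nth_Abs_fps
    by (simp add: mult_ac)
qed

section \<open>Abel summation and rearrangement of double series\<close>

text \<open>The boundary term of the finite summation by parts vanishes in the limit: the partial
  sums of \<open>d\<close> converge and \<open>T\<close> tends to 0.\<close>

lemma summation_by_parts_sums:
  fixes d T :: "nat \<Rightarrow> real"
  assumes d: "summable (\<lambda>n. \<bar>d n\<bar>)" and T: "T \<longlonglongrightarrow> 0"
  shows "(\<lambda>n. (\<Sum>k\<le>n. d k) * (T n - T (Suc n))) sums (\<Sum>n. d n * T n)"
proof -
  have "Bseq T" using T by (intro convergent_imp_Bseq convergentI)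
  then obtain K where K: "\<And>n. norm (T n) \<le> K" by (auto simp: Bseq_def)
  have "summable (\<lambda>n. d n * T n)"
  proof (rule summable_comparison_test')
    show "summable (\<lambda>n. \<bar>d n\<bar> * K)" by (intro summable_mult2 d)
    show "norm (d n * T n) \<le> \<bar>d n\<bar> * K" for n
      using K[of n] by (simp add: abs_mult mult_left_mono)
  qed
  then have lim1: "(\<lambda>n. \<Sum>k<n. d k * T k) \<longlonglongrightarrow> (\<Sum>n. d n * T n)"
    by (rule summable_LIMSEQ)
  have "(\<lambda>n. (\<Sum>k<n. d k) * T n) \<longlonglongrightarrow> suminf d * 0"
    using summable_LIMSEQ[OF summable_rabs_cancel[OF d]] T by (rule tendsto_mult)
  then have lim2: "(\<lambda>n. (\<Sum>k<n. d k) * T n) \<longlonglongrightarrow> 0" by simp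
  have "(\<Sum>n<N. (\<Sum>k\<le>n. d k) * (T n - T (Suc n))) = (\<Sum>k<N. d k * T k) - (\<Sum>k<N. d k) * T N" for N
    by (induction N) (simp_all add: lessThan_Suc_atMost[symmetric] algebra_simps)
  then show ?thesis
    unfolding sums_def using tendsto_diff[OF lim1 lim2] by simp
qed

lemma sum_increments: "(\<Sum>k\<le>n. if k = 0 then c 0 else c k - c (k - 1)) = c n" for c :: "nat \<Rightarrow> real"
  by (induction n) simp_all

lemma summable_abs_increments:
  fixes c :: "nat \<Rightarrow> real"
  assumes "summable (\<lambda>n. \<bar>c (Suc n) - c n\<bar>)"
  shows "summable (\<lambda>k. \<bar>if k = 0 then c 0 else c k - c (k - 1)\<bar>)"
  by (rule summable_Suc_iff[THEN iffD1]) (simp add: assms)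

text \<open>As \<open>T\<close> is bounded, the family \<open>w i * d j * T (i + j)\<close> is
  absolutely summable over all pairs, so its sums by rows and by antidiagonals agree.\<close>

lemma convolution_sums:
  fixes w d T :: "nat \<Rightarrow> real"
  assumes w: "summable (\<lambda>n. \<bar>w n\<bar>)" and d: "summable (\<lambda>n. \<bar>d n\<bar>)" and T: "Bseq T"
  shows "(\<Sum>i. w i * (\<Sum>j. d j * T (i + j))) = (\<Sum>n. (\<Sum>i\<le>n. w i * d (n - i)) * T n)"
    (is "?L = ?R")
    and "summable (\<lambda>n. \<bar>\<Sum>i\<le>n. w i * d (n - i)\<bar>)"
proof -
  obtain K where K: "\<And>n. norm (T n) \<le> K" using T by (auto simp: Bseq_def)
  show "summable (\<lambda>n. \<bar>\<Sum>i\<le>n. w i * d (n - i)\<bar>)"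
  proof (rule summable_comparison_test')
    show "summable (\<lambda>n. \<Sum>i\<le>n. \<bar>w i\<bar> * \<bar>d (n - i)\<bar>)"
      using Cauchy_product_sums[of "\<lambda>n. \<bar>w n\<bar>" "\<lambda>n. \<bar>d n\<bar>"] w d by (auto simp: sums_iff)
    show "norm \<bar>\<Sum>i\<le>n. w i * d (n - i)\<bar> \<le> (\<Sum>i\<le>n. \<bar>w i\<bar> * \<bar>d (n - i)\<bar>)" for n
      by (simp add: sum_abs[THEN order_trans] abs_mult flip: abs_mult)
  qed
  define g where "g = (\<lambda>(i, j). w i * (d j * T (i + j)))"
  have "(\<lambda>(i, j). \<bar>w i\<bar> * \<bar>d j\<bar>) summable_on (UNIV \<times> UNIV)"
  proof (rule summable_on_SigmaI)
    have "(\<lambda>j. \<bar>d j\<bar>) summable_on UNIV" "(\<lambda>j. \<bar>w j\<bar>) summable_on UNIV"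
      using w d by (auto intro!: norm_summable_imp_summable_on)
    then show "((\<lambda>j. case (i, j) of (i, j) \<Rightarrow> \<bar>w i\<bar> * \<bar>d j\<bar>) has_sum \<bar>w i\<bar> * infsum (\<lambda>j. \<bar>d j\<bar>) UNIV) UNIV"
      "(\<lambda>i. \<bar>w i\<bar> * infsum (\<lambda>j. \<bar>d j\<bar>) UNIV) summable_on UNIV" for i
      by (auto intro!: has_sum_cmult_right has_sum_infsum summable_on_cmult_left)
  qed auto
  then have "(\<lambda>z. (case z of (i, j) \<Rightarrow> \<bar>w i\<bar> * \<bar>d j\<bar>) * K) summable_on (UNIV \<times> UNIV)"
    by (rule summable_on_cmult_left)
  then have "(\<lambda>z. norm (g z)) summable_on (UNIV \<times> UNIV)"
    by (rule summable_on_comparison_test)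
      (use K in \<open>auto simp: g_def abs_mult mult.assoc intro!: mult_left_mono\<close>)
  then have "g summable_on (UNIV \<times> UNIV)"
    by (rule abs_summable_summable)
  then obtain S where S: "(g has_sum S) (UNIV \<times> UNIV)"
    by (auto simp: summable_on_def)
  have "((\<lambda>i. w i * (\<Sum>j. d j * T (i + j))) has_sum S) UNIV"
  proof (rule has_sum_SigmaD[OF S])
    fix i
    have "summable (\<lambda>j. norm (d j * T (i + j)))"
    proof (rule summable_comparison_test')
      show "summable (\<lambda>j. \<bar>d j\<bar> * K)" by (intro summable_mult2 d)
      show "norm (norm (d j * T (i + j))) \<le> \<bar>d j\<bar> * K" for j
        using K[of "i + j"] by (simp add: abs_mult mult_left_mono)
    qed
    then have "((\<lambda>j. d j * T (i + j)) has_sum (\<Sum>j. d j * T (i + j))) UNIV"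
      by (blast intro: norm_summable_imp_has_sum summable_sums summable_norm_cancel)
    then show "((\<lambda>j. g (i, j)) has_sum w i * (\<Sum>j. d j * T (i + j))) UNIV"
      by (simp add: g_def has_sum_cmult_right)
  qed
  moreover have "((\<lambda>n. (\<Sum>i\<le>n. w i * d (n - i)) * T n) has_sum S) UNIV"
  proof (rule has_sum_SigmaD)
    show "((\<lambda>(n, i). w i * (d (n - i) * T n)) has_sum S) (SIGMA n:UNIV. {..n})"
      using S by (rule has_sum_reindex_bij_witness
        [where i = "\<lambda>(i, j). (i + j, i)" and j = "\<lambda>(n, i). (i, n - i)", THEN iffD2, rotated -1])
        (auto simp: g_def)
    show "((\<lambda>i. case (n, i) of (n, i) \<Rightarrow> w i * (d (n - i) * T n)) has_sum
        (\<Sum>i\<le>n. w i * d (n - i)) * T n) {..n}" for n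
      by (rule has_sum_finiteI) (simp_all add: sum_distrib_right mult.assoc)
  qed
  ultimately show "?L = ?R"
    by (auto dest!: has_sum_imp_sums simp: sums_iff)
qed

text \<open>No absolute convergence is assumed of \<open>u\<close>, so the double series cannot be rearranged as it stands;
  in terms of the tails of \<open>u\<close> and the differences of \<open>c\<close> it converges absolutely.\<close>

lemma convolution_suminf_bounded_variation:
  fixes w c u :: "nat \<Rightarrow> real"
  assumes w: "summable (\<lambda>n. \<bar>w n\<bar>)" and c: "summable (\<lambda>n. \<bar>c (Suc n) - c n\<bar>)"
    and u: "summable u"
  shows "(\<Sum>i. w i * (\<Sum>j. c j * u (i + j))) = (\<Sum>n. (\<Sum>i\<le>n. w i * c (n - i)) * u n)"
proof -
  define T where "T n = (\<Sum>j. u (j + n))" for n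
  \<comment> \<open>The increments start with \<open>c 0\<close> itself, so their partial sums
    recover \<open>c\<close> with no additive constant.\<close>
  define d where "d k = (if k = 0 then c 0 else c k - c (k - 1))" for k
  have T0: "T \<longlonglongrightarrow> 0"
    unfolding T_def using u by (rule suminf_exist_split2)
  have u_eq: "T n - T (Suc n) = u n" for n
    unfolding T_def using suminf_split_head[of "\<lambda>j. u (j + n)"] u by simp
  have d: "summable (\<lambda>n. \<bar>d n\<bar>)"
    unfolding d_def by (rule summable_abs_increments[OF c])
  have c_eq: "(\<Sum>k\<le>n. d k) = c n" for n
    unfolding d_def by (rule sum_increments)
  have "Bseq T" using T0 by (intro convergent_imp_Bseq convergentI)
  note conv = convolution_sums[OF w d this]
  have "(\<Sum>j. c j * u (i + j)) = (\<Sum>j. d j * T (i + j))" for i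
    using summation_by_parts_sums[OF d LIMSEQ_ignore_initial_segment[OF T0, of i]]
    by (simp add: c_eq u_eq add.commute sums_iff)
  moreover have C_eq: "(\<Sum>k\<le>n. \<Sum>i\<le>k. w i * d (k - i)) = (\<Sum>i\<le>n. w i * c (n - i))" for n
  proof -
    \<comment> \<open>Summing the triangle by \<open>i\<close> first leaves inner sums of
      \<open>d\<close>, which telescope to \<open>c (n - i)\<close>.\<close>
    have "(\<Sum>k\<le>n. \<Sum>i\<le>k. w i * d (k - i)) = (\<Sum>i\<le>n. \<Sum>j\<le>n - i. w i * d j)"
      by (simp add: sum.Sigma)
        (rule sum.reindex_bij_witness
          [where i = "\<lambda>(i, j). (i + j, i)" and j = "\<lambda>(k, i). (i, k - i)"], auto)
    then show ?thesis by (simp add: c_eq flip: sum_distrib_left)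
  qed
  ultimately have "(\<Sum>i. w i * (\<Sum>j. c j * u (i + j))) = (\<Sum>n. (\<Sum>i\<le>n. w i * d (n - i)) * T n)"
    by (simp add: conv(1))
  \<comment> \<open>Abel summation in the other direction, from tails back to terms; the convolution
    of \<open>w\<close> and \<open>d\<close> now plays the role of the increments.\<close>
  also have "\<dots> = (\<Sum>n. (\<Sum>k\<le>n. \<Sum>i\<le>k. w i * d (k - i)) * u n)"
    using summation_by_parts_sums[OF conv(2) T0] by (simp add: u_eq sums_iff)
  finally show ?thesis by (simp only: C_eq)
qed

text \<open>Abel's test: \<open>u\<close> is a convergent series multiplied termwise by the
  reciprocal sequence \<open>qratio r B A\<close>, which has bounded variation.\<close>

lemma summable_qratio_cancel:
  fixes u :: "nat \<Rightarrow> real"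
  assumes "0 < r" "r < 1" "0 < A" "A < 1" "0 < B" "B < 1"
    and su: "summable (\<lambda>n. qratio r A B n * u n)"
  shows "summable u"
proof -
  define v where "v = (\<lambda>n. qratio r A B n * u n)"
  define T where "T n = (\<Sum>j. v (j + n))" for n
  have v: "summable v" using su by (simp add: v_def)
  have T0: "T \<longlonglongrightarrow> 0"
    unfolding T_def using v by (rule suminf_exist_split2)
  have v_eq: "T n - T (Suc n) = v n" for n
    unfolding T_def using suminf_split_head[of "\<lambda>j. v (j + n)"] v by simp
  have "u n = qratio r B A n * (T n - T (Suc n))" for n
    using qratio_mult_swap[of r B A n] assms by (simp add: v_eq v_def flip: mult.assoc)
  then have "u = (\<lambda>n. qratio r B A n * (T n - T (Suc n)))" by (rule ext)
  moreover have "summable (\<lambda>n. qratio r B A n * (T n - T (Suc n)))"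
    using summation_by_parts_sums[OF summable_abs_increments[OF summable_qratio_diff] T0, of r B A] assms
    unfolding sum_increments by (simp add: sums_iff)
  ultimately show ?thesis by simp
qed

section \<open>The kernel on the grid \<open>q ^ i * x\<close> and the series form of the
  operator\<close>

context
  fixes r a :: real
  assumes r: "0 < r" "r < 1" and a: "a > 0"
begin

lemma powr_exponent_less_1: "r powr a < 1"
  using powr_less_mono'[of r 0 a] r a by simp

lemma prodinf_qratio_shift:
  "qratio r r (r powr a) i * prodinf (\<lambda>k. (1 - r * r ^ (k + i)) / (1 - r powr a * r ^ (k + i))) =
   prodinf (\<lambda>k. (1 - r * r ^ k) / (1 - r powr a * r ^ k))" (is "_ * prodinf (\<lambda>k. ?f (k + i)) = _")
  and prodinf_qratio_nonzero:
  "prodinf (\<lambda>k. (1 - r * r ^ k) / (1 - r powr a * r ^ k)) \<noteq> 0"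
proof -
  have conv: "convergent_prod ?f"
    using r powr_exponent_less_1 by (intro convergent_prod_qratio) auto
  have nz: "?f k \<noteq> 0" for k
    using r powr_exponent_less_1 mult_power_neq_1[of r r k] mult_power_neq_1[of "r powr a" r k]
    by simp
  show "qratio r r (r powr a) i * prodinf (\<lambda>k. ?f (k + i)) = prodinf ?f"
    using prodinf_split_initial_segment[OF conv nz, of i]
    by (simp only: qratio_def mult.commute)
  show "prodinf ?f \<noteq> 0"
    using conv nz by (simp add: prodinf_nonzero)
qed

text \<open>The entry \<open>X * r ^ Suc i\<close> shifts the infinite product by \<open>i\<close>
  places. Restoring its first \<open>i\<close> factors costs the reciprocal
  \<open>qratio r (r powr a) r i\<close> and leaves a product independent of
  \<open>i\<close>.\<close>

lemma qdiff_pow_eq: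
  assumes X: "X > 0"
  shows "qdiff_pow r (a - 1) X (X * r ^ Suc i) = X powr (a - 1) * qratio r (r powr a) r i *
    prodinf (\<lambda>k. (1 - r * r ^ k) / (1 - r powr a * r ^ k))"
proof -
  have *: "(X - X * r ^ Suc i * r ^ k) / (X - X * r ^ Suc i * r powr (real k + (a - 1)))
      = (1 - r * r ^ (k + i)) / (1 - r powr a * r ^ (k + i))" for k
  proof -
    have "r ^ Suc i * r powr (real k + (a - 1)) = r powr (a + real (k + i))"
      using r by (simp flip: powr_realpow powr_add del: power_Suc)
        (simp add: algebra_simps flip: power_add)
    also have "\<dots> = r powr a * r ^ (k + i)"
      using r by (simp add: powr_add powr_realpow power_add)
    finally have "X - X * r ^ Suc i * r powr (real k + (a - 1)) = X * (1 - r powr a * r ^ (k + i))"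
      by (simp add: algebra_simps)
    moreover have "X - X * r ^ Suc i * r ^ k = X * (1 - r * r ^ (k + i))"
      by (simp add: right_diff_distrib power_add mult_ac)
    ultimately show ?thesis using X by simp
  qed
  have "qratio r (r powr a) r i * qratio r r (r powr a) i = 1"
    using r powr_exponent_less_1 by (intro qratio_mult_swap) auto
  then have "prodinf (\<lambda>k. (1 - r * r ^ (k + i)) / (1 - r powr a * r ^ (k + i))) =
      qratio r (r powr a) r i * prodinf (\<lambda>k. (1 - r * r ^ k) / (1 - r powr a * r ^ k))"
    by (simp only: mult.assoc[symmetric] prodinf_qratio_shift[of i, symmetric])
  then show ?thesis unfolding qdiff_pow_def * by simp
qed

end

text \<open>The infinite product \<open>P\<close> occurs in every kernel value and in the
  normalizing denominator, hence cancels.\<close>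

lemma qfrac_integral_series:
  fixes p q a x :: real and f :: "real \<Rightarrow> real"
  assumes q: "0 < q" "q < 1" and p: "p > -1" and a: "a > 0" and x: "x > 0"
    and ex: "qfrac_integral_exists p q a f x"
  defines "r \<equiv> q powr (p + 1)"
  shows "summable (\<lambda>i. qratio r (r powr a) r i * (r ^ i * f (q ^ i * x)))"
    and "qfrac_integral p q a f x = (1 - q) powr a * x powr ((p + 1) * a) *
      (\<Sum>i. qratio r (r powr a) r i * (r ^ i * f (q ^ i * x)))"
proof -
  have r: "0 < r" "r < 1"
    using q p powr_less_mono'[of q 0 "p + 1"] by (auto simp: r_def)
  define P where "P = prodinf (\<lambda>k. (1 - r * r ^ k) / (1 - r powr a * r ^ k))"
  have P: "P \<noteq> 0" unfolding P_def by (rule prodinf_qratio_nonzero[OF r a])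
  define X where "X = x powr (p + 1)"
  have X: "X > 0" using x by (simp add: X_def)
  define C where "C = x powr p * X powr (a - 1) * P"
  have C: "C \<noteq> 0" using x X P by (simp add: C_def)
  have q_pow: "(q ^ i) powr (p + 1) = r ^ i" for i
    using q by (simp add: r_def powr_realpow[symmetric] powr_powr mult.commute)
  have summand: "q ^ i * qfrac_integrand p q a f x (q ^ i * x)
      = C * (qratio r (r powr a) r i * (r ^ i * f (q ^ i * x)))" for i
  proof -
    have "(q ^ i * x * q) powr (p + 1) = (q ^ Suc i * x) powr (p + 1)"
      by (simp add: mult_ac)
    also have "\<dots> = X * r ^ Suc i"
      using q x by (simp only: powr_mult q_pow X_def) simp
    finally have "qdiff_pow r (a - 1) X ((q ^ i * x * q) powr (p + 1))
        = X powr (a - 1) * qratio r (r powr a) r i * P"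
      unfolding P_def using qdiff_pow_eq[OF r a X] by simp
    \<comment> \<open>The Jackson weight \<open>q ^ i\<close> and the factor \<open>w powr p\<close>
      combine to \<open>(q ^ i) powr (p + 1)\<close>.\<close>
    moreover have "q ^ i * (q ^ i * x) powr p = r ^ i * x powr p"
      using q x q_pow[of i] by (simp add: powr_mult powr_add mult.commute)
    ultimately show ?thesis
      unfolding qfrac_integrand_def C_def X_def[symmetric] r_def[symmetric]
      by (simp add: mult_ac)
  qed
  show sm: "summable (\<lambda>i. qratio r (r powr a) r i * (r ^ i * f (q ^ i * x)))"
    using ex C unfolding qfrac_integral_exists_def jackson_integrable_def summand by simp
  \<comment> \<open>The normalizing denominator is the kernel with \<open>X = 1\<close> and
    \<open>i = 0\<close>.\<close>
  have norm: "qdiff_pow r (a - 1) 1 r = P"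
    using qdiff_pow_eq[OF r a, of 1 0] by (simp add: P_def)
  have X_eq: "x * x powr p * X powr (a - 1) = x powr ((p + 1) * a)"
    using x by (simp add: X_def powr_powr powr_add[symmetric] powr_mult_base algebra_simps)
  have q_eq: "(1 - q) powr (a - 1) * (1 - q) = (1 - q) powr a"
    using q by (simp add: powr_mult_base mult.commute)
  show "qfrac_integral p q a f x = (1 - q) powr a * x powr ((p + 1) * a) *
      (\<Sum>i. qratio r (r powr a) r i * (r ^ i * f (q ^ i * x)))"
    unfolding qfrac_integral_def jackson_integral_def summand suminf_mult[OF sm]
      r_def[symmetric] norm C_def
    using P by (simp flip: X_eq q_eq)
qed

section \<open>Composition of two operators along the grid\<close>

theorem proposition9:
  fixes p q \<alpha> \<beta> :: real and f :: "real \<Rightarrow> real"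
  assumes "0 < q" and "q < 1" and "p > -1" and "\<alpha> > 0" and "\<beta> > 0"
    and "\<And>x. x > 0 \<Longrightarrow> qfrac_integral_exists p q \<beta> f x"
    and "\<And>x. x > 0 \<Longrightarrow> qfrac_integral_exists p q \<alpha> (qfrac_integral p q \<beta> f) x"
    and "\<And>x. x > 0 \<Longrightarrow> qfrac_integral_exists p q (\<alpha> + \<beta>) f x"
  shows "\<forall>x>0. qfrac_integral p q \<alpha> (qfrac_integral p q \<beta> f) x = qfrac_integral p q (\<alpha> + \<beta>) f x"
proof (intro allI impI)
  fix x :: real assume x: "x > 0"
  note q = assms(1,2) and ex = assms(6-8)
  define r where "r = q powr (p + 1)"
  have r: "0 < r" "r < 1"
    using q assms(3) powr_less_mono'[of q 0 "p + 1"] by (auto simp: r_def)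
  define A where "A = r powr \<alpha>"
  define B where "B = r powr \<beta>"
  have A: "0 < A" "A < 1" and B: "0 < B" "B < 1"
    using r assms(4,5) by (auto simp: A_def B_def powr_exponent_less_1)
  define u where "u n = r ^ n * f (q ^ n * x)" for n
  define w where "w i = qratio r A r i * B ^ i" for i
  define K where "K = (1 - q) powr \<beta> * x powr ((p + 1) * \<beta>)"
  note series = qfrac_integral_series[OF q assms(3), folded r_def]
  have u: "summable u"
    using series(1)[OF assms(5) x ex(1)[OF x]] summable_qratio_cancel[OF r B r]
    by (simp add: u_def[abs_def] B_def)
  have c: "summable (\<lambda>n. \<bar>qratio r B r (Suc n) - qratio r B r n\<bar>)"
    by (rule summable_qratio_diff[OF r B r])
  \<comment> \<open>The weight \<open>B ^ i\<close> makes this series converge absolutely, although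
    \<open>u\<close> need not.\<close>
  have w: "summable (\<lambda>i. \<bar>w i\<bar>)"
  proof -
    obtain M where M: "\<And>n. norm (qratio r A r n) \<le> M"
      using Bseq_qratio[OF r A r] by (auto simp: Bseq_def)
    show ?thesis
    proof (rule summable_comparison_test')
      show "summable (\<lambda>i. M * B ^ i)" using B by (intro summable_mult summable_geometric) auto
      show "norm \<bar>w i\<bar> \<le> M * B ^ i" for i
        using M[of i] B by (simp add: w_def abs_mult mult_right_mono)
    qed
  qed
  \<comment> \<open>The prefactor of the inner operator at \<open>q ^ i * x\<close> contributes
    \<open>B ^ i\<close>, and \<open>r ^ i\<close> turns its terms into the shifted sequence
    \<open>u (i + j)\<close>.\<close>
  have inner: "r ^ i * qfrac_integral p q \<beta> f (q ^ i * x)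
      = K * (B ^ i * (\<Sum>j. qratio r B r j * u (i + j)))" for i
  proof -
    have xi: "q ^ i * x > 0" using q x by simp
    note S = series[OF assms(5) xi ex(1)[OF xi], folded B_def]
    have "(q ^ i) powr ((p + 1) * \<beta>) = B ^ i"
      using q by (simp add: B_def r_def powr_realpow[symmetric] powr_powr mult_ac)
    then have "(q ^ i * x) powr ((p + 1) * \<beta>) = B ^ i * x powr ((p + 1) * \<beta>)"
      using q x by (simp add: powr_mult)
    moreover have "r ^ i * (\<Sum>j. qratio r B r j * (r ^ j * f (q ^ j * (q ^ i * x))))
        = (\<Sum>j. qratio r B r j * u (i + j))"
      by (subst suminf_mult[OF S(1), symmetric]) (simp add: u_def power_add mult_ac)
    ultimately show ?thesis
      unfolding S(2) K_def by (simp add: mult_ac)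
  qed
  note outer = series[OF assms(4) x ex(2)[OF x], folded A_def, unfolded inner]
  have outer_term: "qratio r A r i * (K * (B ^ i * s)) = K * (w i * s)" for i s
    by (simp add: w_def)
  \<comment> \<open>Summability of the outer series is known only with the factor \<open>K\<close>
    included; dividing by \<open>K\<close> allows it to be pulled out of the sum.\<close>
  have K: "K \<noteq> 0" using q x by (simp add: K_def)
  have "qfrac_integral p q \<alpha> (qfrac_integral p q \<beta> f) x
      = (1 - q) powr \<alpha> * x powr ((p + 1) * \<alpha>) *
        (K * (\<Sum>i. w i * (\<Sum>j. qratio r B r j * u (i + j))))"
    using outer K unfolding outer_term by (simp add: suminf_mult)
  also have "(\<Sum>i. w i * (\<Sum>j. qratio r B r j * u (i + j)))
      = (\<Sum>n. (\<Sum>i\<le>n. w i * qratio r B r (n - i)) * u n)"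
    by (rule convolution_suminf_bounded_variation[OF w c u])
  also have "\<dots> = (\<Sum>n. qratio r (A * B) r n * u n)"
    unfolding w_def qVandermonde[OF r B(2)] ..
  also have "(1 - q) powr \<alpha> * x powr ((p + 1) * \<alpha>) * (K * \<dots>)
      = qfrac_integral p q (\<alpha> + \<beta>) f x"
    using series(2)[OF _ x ex(3)[OF x]] assms(4,5)
    by (simp add: A_def B_def K_def u_def powr_add distrib_left)
  finally show "qfrac_integral p q \<alpha> (qfrac_integral p q \<beta> f) x
      = qfrac_integral p q (\<alpha> + \<beta>) f x" .
qed

end
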